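(* If $G$ is an instance of a hierarchical factor graph template with $E$ template factors, then $\mathsf{hw}(G)\le E$, where $\mathsf{hw}(G)$ is the hierarchy width of $G$.
   Context: Factor graphs. A factor graph $G=\langle V,\Phi\rangle$ consists of a finite set $V$ of discrete variables and a finite set $\Phi$ of factors, each depending on some subset of the variables; it is viewed as a bipartite graph in which a variable is joined to a factor iff the factor depends on it, and connectedness refers to this bipartite graph. Hierarchy width $\mathsf{hw}(G)$ is defined recursively: if $G$ has no factors, $\mathsf{hw}(G)=0$; if $G$ is connected (with at least one factor), $\mathsf{hw}(G)=1+\min_{\phi^*\in\Phi}\mathsf{hw}(\langle V,\Phi-\{\phi^*\}\rangle)$; if $G$ is disconnected with connected components $G_1,G_2,\dots$, $\mathsf{hw}(G)=\max_i\mathsf{hw}(G_i)$. Templates. A factor graph template consists of a set of template variables and a set of template factors. A template variable represents a property of a tuple of zero or more objects of particular classes. A template factor $\phi$ is a factor function applied to a finite list of terms, each term being a template variable applied to object symbols, as in $\phi(A(\hat x,\hat y,z),B(\hat x,\hat y),Q(\hat x,\hat y))$; each object symbol ranges over objects of a class. The object symbols of each template factor are divided into two groups, head symbols (written with a hat) and body symbols. Instances. A dataset is a finite set of objects divided into classes. The instantiated factor graph has one variable $A(o_1,\dots,o_r)$ for each template variable $A$ and each tuple of objects of the right classes. For a template factor $\phi$, let $H_\phi$ and $B_\phi$ be the sets of possible assignments of objects to its head symbols and body symbols, and let $\phi(h,b,I)$ be the value of its factor function in world $I$ (an assignment of values to all variables) under the assignment $(h,b)$. For a semantic function $g:\mathbb{R}\to\mathbb{R}$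 and weights $w_\phi(h)$, the energy of a world is $\epsilon(I)=\sum_\phi\sum_{h\in H_\phi}w_\phi(h)\,g\big(\sum_{b\in B_\phi}\phi(h,b,I)\big)$, so that there is a single factor for each template factor $\phi$ and each $h\in H_\phi$; it depends on the variables appearing in the terms of $\phi$ under the assignments $(h,b)$, $b\in B_\phi$. Hierarchical. A template factor has hierarchy depth $d$ if the first $d$ object symbols that appear in each of its terms are the same; these symbols are called hierarchical symbols. A template factor is hierarchical if all of its head symbols are hierarchical symbols. A factor graph template is hierarchical if all its template factors are hierarchical. For example, $\phi(A(\hat x,\hat y,z),B(\hat x,\hat y),Q(\hat x,\hat y))$ has hierarchy depth $2$, with hierarchical symbols $\hat x$ and $\hat y$, and is hierarchical, while $\phi(A(z),B(\hat x),Q(\hat x,y))$ has hierarchy depth $0$ and no hierarchical symbols, and is not hierarchical.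
   Formalization: Hierarchical is read with head symbols first: for some depth d, the first d symbols common to all terms are exactly the head symbols. If body symbols may precede heads the claim fails: φ(A(z,x̂)), ψ(A(ŷ,w)) with two objects has E = 2 but hierarchy width 3. *)

theory Defs
  imports Complex_Main "HOL-Library.FuncSet"
begin

section \<open>Factor graphs\<close>

text \<open>Factors are identified by names of type \<open>'f\<close>, so that distinct factors may have the same
  scope and the same potential. A world is a function \<open>'v \<Rightarrow> 'x\<close>.\<close>

record ('v, 'f, 'x) factor_graph =
  variables :: "'v set"
  factors :: "'f set"
  scope :: "'f \<Rightarrow> 'v set"
  potential :: "'f \<Rightarrow> ('v \<Rightarrow> 'x) \<Rightarrow> real"

definition wf_factor_graph :: "('v, 'f, 'x) factor_graph \<Rightarrow> bool" where
  "wf_factor_graph G \<longleftrightarrow>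
     finite (variables G) \<and> finite (factors G) \<and>
     (\<forall>\<phi>\<in>factors G. scope G \<phi> \<subseteq> variables G \<and>
        (\<forall>I J. (\<forall>v\<in>scope G \<phi>. I v = J v) \<longrightarrow> potential G \<phi> I = potential G \<phi> J))"

definition nodes :: "('v, 'f, 'x) factor_graph \<Rightarrow> ('v + 'f) set" where
  "nodes G = variables G <+> factors G"

definition adjacency :: "('v, 'f, 'x) factor_graph \<Rightarrow> (('v + 'f) \<times> ('v + 'f)) set" where
  "adjacency G =
     (let E = {(Inl v, Inr \<phi>) | v \<phi>. v \<in> variables G \<and> \<phi> \<in> factors G \<and> v \<in> scope G \<phi>}
      in E \<union> E\<inverse>)"

definition reachability :: "('v, 'f, 'x) factor_graph \<Rightarrow> (('v + 'f) \<times> ('v + 'f)) set" where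
  "reachability G = (adjacency G)\<^sup>* \<inter> nodes G \<times> nodes G"

definition connected_fg :: "('v, 'f, 'x) factor_graph \<Rightarrow> bool" where
  "connected_fg G \<longleftrightarrow> (\<forall>x\<in>nodes G. \<forall>y\<in>nodes G. (x, y) \<in> reachability G)"

definition induced_fg :: "('v, 'f, 'x) factor_graph \<Rightarrow> ('v + 'f) set \<Rightarrow> ('v, 'f, 'x) factor_graph" where
  "induced_fg G N = G\<lparr>variables := {v \<in> variables G. Inl v \<in> N},
                      factors := {\<phi> \<in> factors G. Inr \<phi> \<in> N}\<rparr>"

text \<open>A variable on which no factor depends forms a component of its own, and so does a factor
  that depends on no variable.\<close>

definition components_fg :: "('v, 'f, 'x) factor_graph \<Rightarrow> ('v, 'f, 'x) factor_graph set" where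
  "components_fg G = induced_fg G ` (nodes G // reachability G)"

definition remove_factor :: "('v, 'f, 'x) factor_graph \<Rightarrow> 'f \<Rightarrow> ('v, 'f, 'x) factor_graph" where
  "remove_factor G \<phi> = G\<lparr>factors := factors G - {\<phi>}\<rparr>"


section \<open>Hierarchy width\<close>

lemma finite_nodes: "finite (nodes G) \<longleftrightarrow> finite (variables G) \<and> finite (factors G)"
  by (auto simp: nodes_def finite_Plus_iff)

lemma nodes_induced_fg: "nodes (induced_fg G N) = nodes G \<inter> N"
  by (auto simp: nodes_def induced_fg_def)

lemma equiv_reachability: "equiv (nodes G) (reachability G)"
proof (rule equivI)
  have "sym (adjacency G)"
    by (auto simp: adjacency_def Let_def sym_def)
  hence "sym ((adjacency G)\<^sup>*)"
    by (rule sym_rtrancl)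
  thus "sym (reachability G)"
    by (auto simp: reachability_def sym_def)
  show "trans (reachability G)"
    by (auto simp: reachability_def trans_def)
qed (auto simp: reachability_def refl_on_def)

lemma components_fg_smaller:
  assumes "finite (nodes G)" "\<not> connected_fg G" "C \<in> components_fg G"
  shows "card (nodes C) < card (nodes G)"
proof -
  from assms(3) obtain x where x: "x \<in> nodes G" "C = induced_fg G (reachability G `` {x})"
    by (auto simp: components_fg_def quotient_def)
  have "\<not> nodes G \<subseteq> reachability G `` {x}"
  proof
    assume *: "nodes G \<subseteq> reachability G `` {x}"
    have "connected_fg G"
      unfolding connected_fg_def
    proof (intro ballI)
      fix y z assume "y \<in> nodes G" "z \<in> nodes G"
      with * have "(x, y) \<in> reachability G" "(x, z) \<in> reachability G"
        by auto
      thus "(y, z) \<in> reachability G"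
        using equiv_reachability[of G] by (meson equivE symE transE)
    qed
    with assms(2) show False ..
  qed
  hence "nodes C \<subset> nodes G"
    by (auto simp: x(2) nodes_induced_fg)
  with assms(1) show ?thesis
    by (rule psubset_card_mono)
qed

lemma remove_factor_smaller:
  assumes "finite (nodes G)" "\<phi> \<in> factors G"
  shows "card (nodes (remove_factor G \<phi>)) < card (nodes G)"
proof -
  have "nodes (remove_factor G \<phi>) \<subset> nodes G"
    using assms(2) by (auto simp: nodes_def remove_factor_def)
  with assms(1) show ?thesis
    by (rule psubset_card_mono)
qed

text \<open>The value on infinite graphs is arbitrary; lemma \<open>wf_instantiate\<close> below shows that the
  graphs of interest are finite.\<close>

function hw :: "('v, 'f, 'x) factor_graph \<Rightarrow> nat" where
  "hw G =
     (if infinite (nodes G) \<or> factors G = {} then 0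
      else if connected_fg G then 1 + (MIN \<phi>\<in>factors G. hw (remove_factor G \<phi>))
      else (MAX C\<in>components_fg G. hw C))"
  by auto
termination
  by (relation "measure (\<lambda>G. card (nodes G))")
     (auto intro: remove_factor_smaller components_fg_smaller)

declare hw.simps [simp del]


section \<open>Templates\<close>

text \<open>A term is a template variable applied to a list of object symbols. The value of a factor
  function is taken at the list of the values of the terms, in the given order.\<close>

type_synonym ('a, 's) tterm = "'a \<times> 's list"

record ('a, 's, 'c, 'x) template_factor =
  tf_fun :: "'x list \<Rightarrow> real"
  tf_terms :: "('a, 's) tterm list"
  tf_head :: "'s set"
  tf_class :: "'s \<Rightarrow> 'c"

record ('a, 's, 'c, 'x) template =
  template_vars :: "'a set"
  signature :: "'a \<Rightarrow> 'c list"
  template_factors :: "('a, 's, 'c, 'x) template_factor set"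

definition tf_symbols :: "('a, 's, 'c, 'x) template_factor \<Rightarrow> 's set" where
  "tf_symbols \<phi> = (\<Union>(A, ss)\<in>set (tf_terms \<phi>). set ss)"

definition tf_body :: "('a, 's, 'c, 'x) template_factor \<Rightarrow> 's set" where
  "tf_body \<phi> = tf_symbols \<phi> - tf_head \<phi>"

definition wf_template_factor ::
  "('a, 's, 'c, 'x) template \<Rightarrow> ('a, 's, 'c, 'x) template_factor \<Rightarrow> bool" where
  "wf_template_factor T \<phi> \<longleftrightarrow>
     (\<forall>(A, ss)\<in>set (tf_terms \<phi>). A \<in> template_vars T \<and> map (tf_class \<phi>) ss = signature T A) \<and>
     tf_head \<phi> \<subseteq> tf_symbols \<phi>"

definition wf_template :: "('a, 's, 'c, 'x) template \<Rightarrow> bool" where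
  "wf_template T \<longleftrightarrow>
     finite (template_vars T) \<and> finite (template_factors T) \<and>
     (\<forall>\<phi>\<in>template_factors T. wf_template_factor T \<phi>)"


section \<open>Hierarchical templates\<close>

definition has_hierarchy_depth :: "('a, 's, 'c, 'x) template_factor \<Rightarrow> nat \<Rightarrow> bool" where
  "has_hierarchy_depth \<phi> d \<longleftrightarrow>
     (\<exists>p. length p = d \<and> (\<forall>(A, ss)\<in>set (tf_terms \<phi>). take d ss = p))"

definition hierarchical_symbols :: "('a, 's, 'c, 'x) template_factor \<Rightarrow> nat \<Rightarrow> 's set" where
  "hierarchical_symbols \<phi> d = (\<Union>(A, ss)\<in>set (tf_terms \<phi>). set (take d ss))"

text \<open>All head symbols are hierarchical for some depth \<open>d\<close> of the factor. The inclusion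
  \<open>hierarchical_symbols \<phi> d \<subseteq> tf_head \<phi>\<close> states the convention that head symbols are written first:
  no body symbol occurs in the common initial segment that contains the head symbols. (The common
  initial segment may be longer, and then continues with arbitrary symbols; in a one-term factor
  such as \<open>\<phi>(A(x, z))\<close> with head \<open>x\<close> the choice is \<open>d = 1\<close>.) If body symbols could precede head
  symbols, the template with the factors \<open>\<phi>(A(z, x))\<close> and \<open>\<psi>(A(y, w))\<close>, of heads \<open>x\<close> and \<open>y\<close>, would
  count as hierarchical. Over one class of \<open>n\<close> objects its factors and variables form the complete
  bipartite graph \<open>K\<^sub>n\<^sub>,\<^sub>n\<close> with one variable on each edge, of hierarchy width \<open>n + 1\<close>.\<close>

definition hierarchical_factor :: "('a, 's, 'c, 'x) template_factor \<Rightarrow> bool" where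
  "hierarchical_factor \<phi> \<longleftrightarrow>
     (\<exists>d. has_hierarchy_depth \<phi> d \<and>
          tf_head \<phi> \<subseteq> hierarchical_symbols \<phi> d \<and> hierarchical_symbols \<phi> d \<subseteq> tf_head \<phi>)"

definition hierarchical_template :: "('a, 's, 'c, 'x) template \<Rightarrow> bool" where
  "hierarchical_template T \<longleftrightarrow> (\<forall>\<phi>\<in>template_factors T. hierarchical_factor \<phi>)"


section \<open>Instances\<close>

record ('o, 'c) dataset =
  objects :: "'o set"
  obj_class :: "'o \<Rightarrow> 'c"

definition objects_of :: "('o, 'c) dataset \<Rightarrow> 'c \<Rightarrow> 'o set" where
  "objects_of D c = {ob \<in> objects D. obj_class D ob = c}"

definition assignments ::
  "('o, 'c) dataset \<Rightarrow> ('a, 's, 'c, 'x) template_factor \<Rightarrow> 's set \<Rightarrow> ('s \<Rightarrow> 'o) set" where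
  "assignments D \<phi> S = (\<Pi>\<^sub>E s\<in>S. objects_of D (tf_class \<phi> s))"

definition ground_terms ::
  "('a, 's, 'c, 'x) template_factor \<Rightarrow> ('s \<Rightarrow> 'o) \<Rightarrow> ('s \<Rightarrow> 'o) \<Rightarrow> ('a \<times> 'o list) list" where
  "ground_terms \<phi> h b = map (\<lambda>(A, ss). (A, map (override_on b h (tf_head \<phi>)) ss)) (tf_terms \<phi>)"

definition tf_value ::
  "('a, 's, 'c, 'x) template_factor \<Rightarrow> ('s \<Rightarrow> 'o) \<Rightarrow> ('s \<Rightarrow> 'o) \<Rightarrow> ('a \<times> 'o list \<Rightarrow> 'x) \<Rightarrow> real" where
  "tf_value \<phi> h b I = tf_fun \<phi> (map I (ground_terms \<phi> h b))"

definition instantiate ::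
  "('a, 's, 'c, 'x) template \<Rightarrow> ('o, 'c) dataset \<Rightarrow> (real \<Rightarrow> real) \<Rightarrow>
   (('a, 's, 'c, 'x) template_factor \<Rightarrow> ('s \<Rightarrow> 'o) \<Rightarrow> real) \<Rightarrow>
   ('a \<times> 'o list, ('a, 's, 'c, 'x) template_factor \<times> ('s \<Rightarrow> 'o), 'x) factor_graph" where
  "instantiate T D g w =
     \<lparr>variables = {(A, os). A \<in> template_vars T \<and> set os \<subseteq> objects D \<and>
                            map (obj_class D) os = signature T A},
      factors = (SIGMA \<phi>:template_factors T. assignments D \<phi> (tf_head \<phi>)),
      scope = (\<lambda>(\<phi>, h). \<Union>b\<in>assignments D \<phi> (tf_body \<phi>). set (ground_terms \<phi> h b)),
      potential = (\<lambda>(\<phi>, h) I. w \<phi> h * g (\<Sum>b\<in>assignments D \<phi> (tf_body \<phi>). tf_value \<phi> h b I))\<rparr>"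

definition is_instance ::
  "('a \<times> 'o list, ('a, 's, 'c, 'x) template_factor \<times> ('s \<Rightarrow> 'o), 'x) factor_graph \<Rightarrow>
   ('a, 's, 'c, 'x) template \<Rightarrow> bool" where
  "is_instance G T \<longleftrightarrow> (\<exists>D g w. finite (objects D) \<and> G = instantiate T D g w)"

lemma ground_terms_in_variables:
  assumes "wf_template_factor T \<phi>" "h \<in> assignments D \<phi> (tf_head \<phi>)"
    "b \<in> assignments D \<phi> (tf_body \<phi>)" "v \<in> set (ground_terms \<phi> h b)"
  shows "v \<in> variables (instantiate T D g w)"
proof -
  let ?m = "override_on b h (tf_head \<phi>)"
  obtain A ss where t: "(A, ss) \<in> set (tf_terms \<phi>)" "v = (A, map ?m ss)"
    using assms(4) by (auto simp: ground_terms_def)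
  have m: "?m s \<in> objects_of D (tf_class \<phi> s)" if "s \<in> tf_symbols \<phi>" for s
    using assms(2,3) that
    by (auto simp: override_on_def assignments_def tf_body_def PiE_iff)
  have ss: "set ss \<subseteq> tf_symbols \<phi>"
    using t(1) by (auto simp: tf_symbols_def)
  have "A \<in> template_vars T" "map (tf_class \<phi>) ss = signature T A"
    using assms(1) t(1) by (auto simp: wf_template_factor_def)
  moreover have "map (obj_class D) (map ?m ss) = map (tf_class \<phi>) ss"
    using m ss by (auto simp: objects_of_def)
  moreover have "set (map ?m ss) \<subseteq> objects D"
    using m ss by (auto simp: objects_of_def)
  ultimately show ?thesis
    by (simp add: instantiate_def t(2))
qed

lemma wf_instantiate:
  assumes "wf_template T" "finite (objects D)"
  shows "wf_factor_graph (instantiate T D g w)"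
proof -
  have "variables (instantiate T D g w) \<subseteq>
      (SIGMA A:template_vars T. {os. set os \<subseteq> objects D \<and> length os = length (signature T A)})"
    by (auto simp: instantiate_def dest: arg_cong[where f = length])
  moreover have "finite \<dots>"
    using assms by (auto simp: wf_template_def intro: finite_lists_length_eq)
  ultimately have 1: "finite (variables (instantiate T D g w))"
    by (rule finite_subset)
  have "finite (tf_head \<phi>)" if "\<phi> \<in> template_factors T" for \<phi>
  proof -
    have "finite (tf_symbols \<phi>)"
      by (auto simp: tf_symbols_def)
    moreover have "tf_head \<phi> \<subseteq> tf_symbols \<phi>"
      using that assms(1) by (auto simp: wf_template_def wf_template_factor_def)
    ultimately show ?thesis
      by (rule rev_finite_subset)
  qed
  hence 2: "finite (factors (instantiate T D g w))"
    using assms by (auto simp: instantiate_def assignments_def wf_template_def objects_of_def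
        intro!: finite_SigmaI finite_PiE)
  have 3: "scope (instantiate T D g w) \<psi> \<subseteq> variables (instantiate T D g w)"
    if "\<psi> \<in> factors (instantiate T D g w)" for \<psi>
  proof
    fix v assume v: "v \<in> scope (instantiate T D g w) \<psi>"
    obtain \<phi> h where \<psi>: "\<psi> = (\<phi>, h)"
      by (cases \<psi>)
    from v \<psi> obtain b where "b \<in> assignments D \<phi> (tf_body \<phi>)" "v \<in> set (ground_terms \<phi> h b)"
      by (auto simp: instantiate_def)
    thus "v \<in> variables (instantiate T D g w)"
      using that \<psi> assms(1)
      by (intro ground_terms_in_variables) (auto simp: instantiate_def wf_template_def)
  qed
  have 4: "potential (instantiate T D g w) \<psi> I = potential (instantiate T D g w) \<psi> J"
    if "\<forall>v\<in>scope (instantiate T D g w) \<psi>. I v = J v" for \<psi> I J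
  proof -
    obtain \<phi> h where \<psi>: "\<psi> = (\<phi>, h)"
      by (cases \<psi>)
    have "tf_value \<phi> h b I = tf_value \<phi> h b J" if "b \<in> assignments D \<phi> (tf_body \<phi>)" for b
    proof -
      have "map I (ground_terms \<phi> h b) = map J (ground_terms \<phi> h b)"
        using \<open>\<forall>v\<in>_. I v = J v\<close> that by (auto simp: \<psi> instantiate_def)
      thus ?thesis
        unfolding tf_value_def by (rule arg_cong)
    qed
    thus ?thesis
      by (simp add: \<psi> instantiate_def)
  qed
  show ?thesis
    unfolding wf_factor_graph_def using 1 2 3 4 by blast
qed

end

theory Submission
  imports Defs
begin

text \<open>Every variable on which a factor \<open>(\<phi>, h)\<close> depends has an object list that starts with the
  objects assigned by \<open>h\<close> to the hierarchical symbols of \<open>\<phi>\<close>. If \<open>d\<close> is the least hierarchy depth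
  among the template factors present in a connected graph, then the first \<open>d\<close> objects are the same
  throughout the graph, so a template factor of depth \<open>d\<close> has only one instance there. Removing that
  instance removes a template factor, and passing to a component adds none; hence the hierarchy
  width is at most the number of template factors present.\<close>

lemma label_rtrancl_adjacency:
  assumes "(x, y) \<in> (adjacency G)\<^sup>*"
    and "\<And>v f. f \<in> factors G \<Longrightarrow> v \<in> scope G f \<Longrightarrow> l (Inl v) = l (Inr f)"
  shows "l x = l y"
  using assms(1)
proof (induction rule: rtrancl_induct)
  case (step y z)
  then have "l y = l z"
    by (auto simp: adjacency_def Let_def assms(2))
  with step.IH show ?case by simp
qed simp

text \<open>Abstracted from templates so that the recursion of \<open>hw\<close> can be followed: a
  graph with factors removed need not be an instance, but all three hypotheses survive, since they
  mention only \<open>scope\<close>, which both removal and passing to a component leave unchanged,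
  and the shrinking factor set. A tag stands for a template factor, a key for a list of
  objects.\<close>

lemma hw_le_card_tags:
  fixes G :: "('v, 'f, 'x) factor_graph"
    and tag :: "'f \<Rightarrow> 't" and depth :: "'t \<Rightarrow> nat"
    and vkey :: "'v \<Rightarrow> 'k list" and fkey :: "'f \<Rightarrow> 'k list"
  assumes "\<And>f v. f \<in> factors G \<Longrightarrow> v \<in> scope G f \<Longrightarrow> take (depth (tag f)) (vkey v) = fkey f"
    and "\<And>f. f \<in> factors G \<Longrightarrow> length (fkey f) = depth (tag f)"
    and "inj_on (\<lambda>f. (tag f, fkey f)) (factors G)"
  shows "hw G \<le> card (tag ` factors G)"
  using assms
proof (induction G rule: hw.induct)
  case (1 G)
  note key = "1.prems"(1) and len = "1.prems"(2) and inj = "1.prems"(3)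
  show ?case
  proof (cases "infinite (nodes G) \<or> factors G = {}")
    case True
    then show ?thesis by (simp add: hw.simps[of G])
  next
    case nontrivial: False
    then have fin: "finite (factors G)" and ne: "factors G \<noteq> {}"
      by (auto simp: finite_nodes)
    show ?thesis
    proof (cases "connected_fg G")
      case True
      obtain f where f: "f \<in> factors G"
        and min: "\<And>f'. f' \<in> factors G \<Longrightarrow> depth (tag f) \<le> depth (tag f')"
        using ex_min_if_finite[of "(\<lambda>f. depth (tag f)) ` factors G"] fin ne
        by (fastforce simp: not_less)
      \<comment> \<open>Cut to the least depth, the key of a factor agrees with that of each
        variable in its scope, because the depth of that factor is at least as large.\<close>
      define l where "l = (\<lambda>x. take (depth (tag f)) (case_sum vkey fkey x))"
      have unique: "f' = f" if f': "f' \<in> factors G" "tag f' = tag f" for f'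
      proof -
        have "(Inr f', Inr f) \<in> (adjacency G)\<^sup>*"
          using True f f'(1) by (auto simp: connected_fg_def reachability_def nodes_def)
        then have "l (Inr f') = l (Inr f)"
        proof (rule label_rtrancl_adjacency)
          fix v f' assume "f' \<in> factors G" "v \<in> scope G f'"
          then show "l (Inl v) = l (Inr f')"
            using min key[of f' v, symmetric] by (simp add: l_def min_absorb1)
        qed
        \<comment> \<open>Equal tags give both keys exactly the length at which \<open>l\<close>
          cuts, so nothing is lost and injectivity applies.\<close>
        then have "fkey f' = fkey f"
          using len[of f'] len[of f] f f' by (simp add: l_def)
        with inj f f' show ?thesis by (auto dest: inj_onD)
      qed
      have "hw G = 1 + (MIN f\<in>factors G. hw (remove_factor G f))"
        using nontrivial True by (simp add: hw.simps[of G])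
      also have "\<dots> \<le> 1 + hw (remove_factor G f)"
        using fin f by simp
      also have "hw (remove_factor G f) \<le> card (tag ` factors (remove_factor G f))"
        using nontrivial True f
        by (intro "1.IH"(1)) (auto simp: remove_factor_def key len intro: inj_on_subset[OF inj])
      also have "tag ` factors (remove_factor G f) = tag ` factors G - {tag f}"
        using unique by (auto simp: remove_factor_def)
      also have "1 + card \<dots> = card (tag ` factors G)"
        using fin f card_Suc_Diff1[of "tag ` factors G" "tag f"] by simp
      finally show ?thesis by simp
    next
      case False
      have "hw C \<le> card (tag ` factors G)" if C: "C \<in> components_fg G" for C
      proof -
        have sub: "factors C \<subseteq> factors G" "scope C = scope G"
          using C by (auto simp: components_fg_def induced_fg_def)
        have "hw C \<le> card (tag ` factors C)"
          using nontrivial False C sub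
          by (intro "1.IH"(2)) (auto simp: key len subset_iff intro: inj_on_subset[OF inj])
        also have "\<dots> \<le> card (tag ` factors G)"
          using sub fin by (intro card_mono) auto
        finally show ?thesis .
      qed
      moreover have "finite (components_fg G)"
        using nontrivial finite_quotient[of "nodes G" "reachability G"] equiv_reachability[of G]
        by (auto simp: components_fg_def reachability_def)
      \<comment> \<open>\<open>Max\<close> is unspecified on the empty set, so bounding each
        component is not enough by itself.\<close>
      moreover have "components_fg G \<noteq> {}"
        using ne by (auto simp: components_fg_def quotient_def nodes_def)
      ultimately show ?thesis
        using nontrivial False by (simp add: hw.simps[of G])
    qed
  qed
qed

text \<open>The inclusion \<open>set p \<subseteq> tf_head \<phi>\<close> is claimed only in the
  presence of a term: a factor without terms has no hierarchical symbols, and \<open>p\<close> is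
  then an arbitrary list.\<close>

lemma hierarchical_factor_prefix:
  assumes "hierarchical_factor \<phi>"
  obtains p where "tf_head \<phi> \<subseteq> set p"
    and "\<And>A ss. (A, ss) \<in> set (tf_terms \<phi>) \<Longrightarrow> take (length p) ss = p \<and> set p \<subseteq> tf_head \<phi>"
proof -
  from assms obtain p where
    "\<forall>(A, ss)\<in>set (tf_terms \<phi>). take (length p) ss = p"
    "tf_head \<phi> = hierarchical_symbols \<phi> (length p)"
    unfolding hierarchical_factor_def has_hierarchy_depth_def by blast
  then show thesis
    by (intro that[of p]) (fastforce simp: hierarchical_symbols_def)+
qed

theorem lemma7:
  fixes T :: "('a, 's, 'c, 'x) template"
    and G :: "('a \<times> 'o list, ('a, 's, 'c, 'x) template_factor \<times> ('s \<Rightarrow> 'o), 'x) factor_graph"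
    and E :: nat
  assumes "wf_template T"
    and "hierarchical_template T"
    and "card (template_factors T) = E"
    and "is_instance G T"
  shows "hw G \<le> E"
proof -
  obtain D g w where G: "G = instantiate T D g w"
    using assms(4) by (auto simp: is_instance_def)
  have "\<exists>p. tf_head \<phi> \<subseteq> set p \<and>
      (\<forall>A ss. (A, ss) \<in> set (tf_terms \<phi>) \<longrightarrow> take (length p) ss = p \<and> set p \<subseteq> tf_head \<phi>)"
    if "\<phi> \<in> template_factors T" for \<phi>
    using assms(2) that hierarchical_factor_prefix[of \<phi>] unfolding hierarchical_template_def by metis
  then obtain p where head: "\<And>\<phi>. \<phi> \<in> template_factors T \<Longrightarrow> tf_head \<phi> \<subseteq> set (p \<phi>)"
    and prefix: "\<And>\<phi> A ss. \<phi> \<in> template_factors T \<Longrightarrow> (A, ss) \<in> set (tf_terms \<phi>) \<Longrightarrow>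
      take (length (p \<phi>)) ss = p \<phi> \<and> set (p \<phi>) \<subseteq> tf_head \<phi>"
    by metis
  have "hw G \<le> card (fst ` factors G)"
  \<comment> \<open>The key of a ground variable is its object list; that of
    \<open>(\<phi>, h)\<close> is the list of objects that \<open>h\<close> gives to the common
    prefix \<open>p \<phi>\<close>.\<close>
  proof (rule hw_le_card_tags[where depth = "\<lambda>\<phi>. length (p \<phi>)" and vkey = snd
        and fkey = "\<lambda>(\<phi>, h). map h (p \<phi>)"])
    fix f v assume fv: "f \<in> factors G" "v \<in> scope G f"
    obtain \<phi> h where f: "f = (\<phi>, h)" by (cases f)
    from fv f have \<phi>: "\<phi> \<in> template_factors T" by (simp add: G instantiate_def)
    from fv f obtain b A ss where t: "(A, ss) \<in> set (tf_terms \<phi>)"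
      and v: "v = (A, map (override_on b h (tf_head \<phi>)) ss)"
      by (auto simp: G instantiate_def ground_terms_def)
    have "take (length (p \<phi>)) (snd v) = map (override_on b h (tf_head \<phi>)) (p \<phi>)"
      using prefix[OF \<phi> t] by (simp add: v take_map)
    \<comment> \<open>No body symbol occurs in the prefix, so the result does not depend on
      \<open>b\<close>.\<close>
    also have "\<dots> = map h (p \<phi>)"
      using prefix[OF \<phi> t] by (auto simp: subset_iff)
    finally show "take (length (p (fst f))) (snd v) = (case f of (\<phi>, h) \<Rightarrow> map h (p \<phi>))"
      by (simp add: f)
  next
    show "inj_on (\<lambda>f. (fst f, case f of (\<phi>, h) \<Rightarrow> map h (p \<phi>))) (factors G)"
    proof (rule inj_onI, clarsimp)
      fix \<phi> h h' assume h: "(\<phi>, h) \<in> factors G" "(\<phi>, h') \<in> factors G" "\<forall>s\<in>set (p \<phi>). h s = h' s"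
      then have "tf_head \<phi> \<subseteq> set (p \<phi>)"
        and "h \<in> assignments D \<phi> (tf_head \<phi>)" "h' \<in> assignments D \<phi> (tf_head \<phi>)"
        using head by (auto simp: G instantiate_def)
      \<comment> \<open>Assignments are extensional functions on the head symbols, all of which lie
        in \<open>p \<phi>\<close>, so agreement there is equality.\<close>
      with h(3) show "h = h'"
        unfolding assignments_def by (blast intro: PiE_ext)
    qed
  qed (auto split: prod.splits)
  also have "\<dots> \<le> card (template_factors T)"
    using assms(1) by (intro card_mono) (auto simp: G instantiate_def wf_template_def)
  finally show ?thesis
    using assms(3) by simp
qed

end
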